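(* Let $G$ be an $n$-vertex graph with characteristic polynomial $\chi(G;x)=x^n+c_1x^{n-1}+\cdots+c_{n-1}x+c_n$, and let $f_2(G;x)$ be a monic integer polynomial whose reduction over $\mathbb{F}_2$ is $\chi(G;x)/\operatorname{sqrt}\Phi_2(G;x)$. Then \[ f_2(G;x)\equiv\begin{cases} x^{n/2}+c_2x^{(n-2)/2}+\cdots+c_{n-2}x+c_n \pmod 2 & n \text{ even},\\ x\big(x^{(n-1)/2}+c_2x^{(n-3)/2}+\cdots+c_{n-3}x+c_{n-1}\big)\pmod 2 & n\text{ odd}.\end{cases} \]
   Context: $A$ is the adjacency matrix, $J$ the all-ones matrix, $\chi(G;x)=\det(xI-A)$. $\Phi_2(G;x)=\gcd(\chi(A;x),\chi(A+J;x))$, monic gcd in $\mathbb{F}_2[x]$. For monic $f=\prod_i f_i^{e_i}$ with distinct monic irreducibles $f_i$, $\operatorname{sqrt}(f)=\prod_i f_i^{\lceil e_i/2\rceil}$. *)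

theory Defs
  imports
    "HOL-Library.Z2"
    "HOL-Number_Theory.Cong"
    "HOL-Computational_Algebra.Polynomial_Factorial"
    "HOL-Computational_Algebra.Field_as_Ring"
    "Jordan_Normal_Form.Char_Poly"
    "Graph_Theory.Digraph"
begin

text \<open>
  The two-element field is \<^typ>\<open>bit\<close>. The library does not equip it with the class
  \<^class>\<open>field_gcd\<close>, which provides the gcd on \<^typ>\<open>bit poly\<close>; the instance is the same as the
  one for \<^typ>\<open>rat\<close> and \<^typ>\<open>real\<close>.
\<close>

instantiation bit ::
  "{unique_euclidean_ring, normalization_euclidean_semiring, normalization_semidom_multiplicative}"
begin

definition [simp]: "normalize_bit = (normalize_field :: bit \<Rightarrow> _)"
definition [simp]: "unit_factor_bit = (unit_factor_field :: bit \<Rightarrow> _)"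
definition [simp]: "euclidean_size_bit = (euclidean_size_field :: bit \<Rightarrow> _)"
definition [simp]: "division_segment (x :: bit) = 1"

instance
  by standard
    (simp_all add: dvd_field_iff modulo_bit_def flip: zero_bit_def split: if_splits)

end

instantiation bit :: euclidean_ring_gcd
begin

definition gcd_bit :: "bit \<Rightarrow> bit \<Rightarrow> bit" where
  "gcd_bit = Euclidean_Algorithm.gcd"
definition lcm_bit :: "bit \<Rightarrow> bit \<Rightarrow> bit" where
  "lcm_bit = Euclidean_Algorithm.lcm"
definition Gcd_bit :: "bit set \<Rightarrow> bit" where
  "Gcd_bit = Euclidean_Algorithm.Gcd"
definition Lcm_bit :: "bit set \<Rightarrow> bit" where
  "Lcm_bit = Euclidean_Algorithm.Lcm"

instance by standard (simp_all add: gcd_bit_def lcm_bit_def Gcd_bit_def Lcm_bit_def)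

end

instance bit :: field_gcd ..

text \<open>
  The list \<open>vs\<close> is meant to enumerate the vertices of \<open>G\<close> without repetition; it fixes the order
  of the rows and columns.
\<close>

definition adjacency_matrix :: "('a, 'b) pre_digraph \<Rightarrow> 'a list \<Rightarrow> int mat" where
  "adjacency_matrix G vs =
     mat (length vs) (length vs) (\<lambda>(i, j). if vs ! i \<rightarrow>\<^bsub>G\<^esub> vs ! j then 1 else 0)"

definition all_ones_matrix :: "nat \<Rightarrow> int mat" where
  "all_ones_matrix n = mat n n (\<lambda>_. 1)"

abbreviation reduce_mod2 :: "int poly \<Rightarrow> bit poly" where
  "reduce_mod2 f \<equiv> map_poly of_int f"

text \<open>On \<^typ>\<open>bit poly\<close>, \<^const>\<open>gcd\<close> is normalized, hence it is the monic gcd.\<close>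

definition Phi2 :: "int mat \<Rightarrow> bit poly" where
  "Phi2 A = gcd (reduce_mod2 (char_poly A))
                (reduce_mod2 (char_poly (A + all_ones_matrix (dim_row A))))"

definition poly_sqrt :: "'a :: field_gcd poly \<Rightarrow> 'a poly" where
  "poly_sqrt f =
     (\<Prod>p | irreducible p \<and> lead_coeff p = 1 \<and> p dvd f. p ^ nat \<lceil>real (multiplicity p f) / 2\<rceil>)"

definition poly_cong :: "int poly \<Rightarrow> int poly \<Rightarrow> int \<Rightarrow> bool" where
  "poly_cong f g m \<longleftrightarrow> (\<forall>i. [coeff f i = coeff g i] (mod m))"

end

(* Let X be the reduction of the characteristic polynomial of A modulo 2.  The coefficients of X in
   degrees of the wrong parity vanish, so by Frobenius X = g^2 for even n and X = x g^2 for odd n,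
   where g is the polynomial with coefficients c_0, c_2, c_4, ...  Moreover
   det(xI - A - J) = X + X' over F_2, so that Phi_2 = gcd(X, X').  For even n the derivative is 0 and
   Phi_2 = X = g^2; for odd n the derivative is g^2 and again Phi_2 = g^2.  Hence sqrt Phi_2 = g and
   X / g is g or x g. *)
theory Submission
  imports Defs
begin

section \<open>Adding the all-ones matrix in characteristic 2\<close>

text \<open>The matrix determinant lemma, with the adjugate in place of the inverse so that no
  division occurs. Both evaluations are compared after multiplication by \<open>det M\<close>, which
  is cancelled at the end.\<close>

lemma det_add_outer_product:
  fixes M :: "'a :: idom mat"
  assumes M: "M \<in> carrier_mat n n" and U: "U \<in> carrier_mat n 1" and V: "V \<in> carrier_mat 1 n"
    and det: "det M \<noteq> 0"
  shows "det (M + U * V) = det M + (V * adj_mat M * U) $$ (0, 0)"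
proof -
  note adj = adj_mat[OF M]
  \<comment> \<open>Clearing the first block column of \<open>B\<close> by row operations (\<open>L\<close>),
    respectively column operations (\<open>R\<close>), evaluates \<open>det B\<close> in two ways.\<close>
  define B where "B = four_block_mat (1\<^sub>m 1) V (- U) M"
  define L where "L = four_block_mat (1\<^sub>m 1) (0\<^sub>m 1 n) U (1\<^sub>m n)"
  define R where "R = four_block_mat (det M \<cdot>\<^sub>m 1\<^sub>m 1) (0\<^sub>m 1 n) (adj_mat M * U) (1\<^sub>m n)"
  have car: "B \<in> carrier_mat (1 + n) (1 + n)" "L \<in> carrier_mat (1 + n) (1 + n)"
    "R \<in> carrier_mat (1 + n) (1 + n)"
    unfolding B_def L_def R_def using M U V by auto
  have aU: "adj_mat M * U \<in> carrier_mat n 1" using adj U by simp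
  have "L * B = four_block_mat (1\<^sub>m 1 * 1\<^sub>m 1 + 0\<^sub>m 1 n * (- U)) (1\<^sub>m 1 * V + 0\<^sub>m 1 n * M)
      (U * 1\<^sub>m 1 + 1\<^sub>m n * (- U)) (U * V + 1\<^sub>m n * M)"
    unfolding L_def B_def by (rule mult_four_block_mat) (use M U V in auto)
  also have "\<dots> = four_block_mat (1\<^sub>m 1) V (0\<^sub>m n 1) (M + U * V)"
    by (intro cong_four_block_mat eq_matI) (use M U V in \<open>auto simp: scalar_prod_def\<close>)
  finally have "det (L * B) = det (M + U * V)"
    using det_four_block_mat_lower_left_zero[of "1\<^sub>m 1" 1 V n "0\<^sub>m n 1" "M + U * V"] M U V
    by simp
  moreover have "det L = 1"
    unfolding L_def by (subst det_four_block_mat_upper_right_zero[where n = 1 and m = n]) (use U in auto)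
  ultimately have B: "det B = det (M + U * V)"
    using det_mult[OF car(2,1)] by simp
  have "B * R = four_block_mat (1\<^sub>m 1 * (det M \<cdot>\<^sub>m 1\<^sub>m 1) + V * (adj_mat M * U))
      (1\<^sub>m 1 * 0\<^sub>m 1 n + V * 1\<^sub>m n)
      (- U * (det M \<cdot>\<^sub>m 1\<^sub>m 1) + M * (adj_mat M * U)) (- U * 0\<^sub>m 1 n + M * 1\<^sub>m n)"
    unfolding B_def R_def by (rule mult_four_block_mat) (use M U V aU in auto)
  \<comment> \<open>The corner of \<open>R\<close> is scaled by \<open>det M\<close> because
    \<open>M * adj_mat M\<close> is \<open>det M\<close> times the identity: the lower left block of
    \<open>B * R\<close> then cancels.\<close>
  also have "M * (adj_mat M * U) = det M \<cdot>\<^sub>m U"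
    using assoc_mult_mat[OF M adj(1) U, symmetric] adj(2) U mult_smult_assoc_mat[OF one_carrier_mat U]
    by simp
  also have "four_block_mat (1\<^sub>m 1 * (det M \<cdot>\<^sub>m 1\<^sub>m 1) + V * (adj_mat M * U))
      (1\<^sub>m 1 * 0\<^sub>m 1 n + V * 1\<^sub>m n)
      (- U * (det M \<cdot>\<^sub>m 1\<^sub>m 1) + det M \<cdot>\<^sub>m U) (- U * 0\<^sub>m 1 n + M * 1\<^sub>m n)
    = four_block_mat (det M \<cdot>\<^sub>m 1\<^sub>m 1 + V * adj_mat M * U) V (0\<^sub>m n 1) M"
    by (intro cong_four_block_mat eq_matI)
      (use M U V adj in \<open>auto simp: scalar_prod_def\<close>)
  finally have "det (B * R) = det (det M \<cdot>\<^sub>m 1\<^sub>m 1 + V * adj_mat M * U) * det M"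
    using det_four_block_mat_lower_left_zero[of "det M \<cdot>\<^sub>m 1\<^sub>m 1 + V * adj_mat M * U" 1 V n "0\<^sub>m n 1" M]
      M U V adj by simp
  moreover have "det (det M \<cdot>\<^sub>m 1\<^sub>m 1 + V * adj_mat M * U) = det M + (V * adj_mat M * U) $$ (0, 0)"
    using U V adj by (subst det_single) auto
  moreover have "det R = det M"
    unfolding R_def
    by (subst det_four_block_mat_upper_right_zero[where n = 1 and m = n]) (use aU in auto)
  ultimately have "det B * det M = (det M + (V * adj_mat M * U) $$ (0, 0)) * det M"
    using det_mult[OF car(1,3)] by simp
  with det B show ?thesis by simp
qed

lemma adj_mat_transpose:
  fixes M :: "'a :: comm_ring_1 mat"
  assumes M: "M \<in> carrier_mat n n"
  shows "adj_mat (M\<^sup>T) = (adj_mat M)\<^sup>T"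
proof (rule eq_matI)
  fix i j assume ij: "i < dim_row (adj_mat M)\<^sup>T" "j < dim_col (adj_mat M)\<^sup>T"
  have "(mat_delete (M\<^sup>T) j i)\<^sup>T = mat_delete M i j"
    unfolding mat_delete_def using M by auto
  moreover have "mat_delete (M\<^sup>T) j i \<in> carrier_mat (n - 1) (n - 1)"
    using M by (intro mat_delete_carrier) simp
  ultimately have "det (mat_delete (M\<^sup>T) j i) = det (mat_delete M i j)"
    by (metis det_transpose)
  then show "adj_mat (M\<^sup>T) $$ (i, j) = (adj_mat M)\<^sup>T $$ (i, j)"
    using ij M by (simp add: adj_mat_def cofactor_def add.commute)
qed (use M in \<open>auto simp: adj_mat_def\<close>)

text \<open>Each induction step adds a row and a column with equal sums by symmetry. Together, apart
  from the corner, they contribute twice the same value, hence 0.\<close>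

lemma symmetric_double_sum_char_2:
  fixes f :: "nat \<Rightarrow> nat \<Rightarrow> 'a :: comm_ring_1"
  assumes two: "(2 :: 'a) = 0" and sym: "\<And>i j. i < n \<Longrightarrow> j < n \<Longrightarrow> f i j = f j i"
  shows "(\<Sum>i<n. \<Sum>j<n. f i j) = (\<Sum>i<n. f i i)"
  using sym
proof (induction n)
  case (Suc n)
  have "(\<Sum>i<n. f i n) = (\<Sum>j<n. f n j)"
    by (intro sum.cong) (auto simp: Suc.prems)
  then show ?case
    using Suc two by (simp add: sum.distrib algebra_simps)
qed simp

text \<open>The all-ones matrix is \<open>e e\<^sup>T\<close>, so the perturbation contributes \<open>e\<^sup>T adj(xI - A) e\<close>;
  in characteristic 2 the off-diagonal entries of the symmetric adjugate cancel in pairs and its trace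
  is the derivative of \<open>det (xI - A)\<close>.\<close>

lemma char_poly_add_all_ones_char_2:
  fixes A :: "'a :: idom mat"
  assumes A: "A \<in> carrier_mat n n" and sym: "A\<^sup>T = A" and two: "(2 :: 'a) = 0"
  shows "char_poly (A + mat n n (\<lambda>_. 1)) = char_poly A + pderiv (char_poly A)"
proof -
  define M where "M = char_poly_matrix A"
  define U :: "'a poly mat" where "U = mat n 1 (\<lambda>_. 1)"
  define V :: "'a poly mat" where "V = mat 1 n (\<lambda>_. 1)"
  have M: "M \<in> carrier_mat n n" unfolding M_def using A by simp
  have U: "U \<in> carrier_mat n 1" and V: "V \<in> carrier_mat 1 n" unfolding U_def V_def by auto
  note adj = adj_mat[OF M]
  have Msym: "M\<^sup>T = M"
    unfolding M_def char_poly_matrix_def using A sym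
    by (intro eq_matI) (auto, metis carrier_matD index_transpose_mat(1))
  have two': "(2 :: 'a poly) = 0"
    using two by (metis of_nat_numeral of_nat_poly pCons_0_0)
  \<comment> \<open>The perturbed matrix is xI - A - J; this sign change turns the subtraction of J
    into the addition of \<open>U * V\<close>.\<close>
  have "(-1 :: 'a) = 1"
    using two by (metis add_eq_0_iff one_add_one)
  then have "char_poly_matrix (A + mat n n (\<lambda>_. 1)) = M + U * V"
    unfolding M_def char_poly_matrix_def U_def V_def using A
    by (intro eq_matI) (auto simp: scalar_prod_def one_pCons)
  moreover have "det M \<noteq> 0"
    using degree_monic_char_poly[OF A] unfolding M_def char_poly_def by auto
  ultimately have "char_poly (A + mat n n (\<lambda>_. 1)) = char_poly A + (V * adj_mat M * U) $$ (0, 0)"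
    using det_add_outer_product[OF M U V] unfolding char_poly_def M_def by simp
  also have "(V * adj_mat M * U) $$ (0, 0) = (\<Sum>j<n. \<Sum>i<n. adj_mat M $$ (i, j))"
    using adj unfolding U_def V_def by (simp add: scalar_prod_def atLeast0LessThan)
  also have "\<dots> = (\<Sum>i<n. adj_mat M $$ (i, i))"
  proof (rule symmetric_double_sum_char_2[OF two'])
    fix i j assume "i < n" "j < n"
    then show "adj_mat M $$ (j, i) = adj_mat M $$ (i, j)"
      using adj_mat_transpose[OF M] Msym adj(1) by (metis carrier_matD index_transpose_mat(1))
  qed
  \<comment> \<open>Diagonal cofactors have sign +1, and the principal minors of xI - A are the
    characteristic polynomials whose sum is the derivative.\<close>
  also have "\<dots> = (\<Sum>i<n. char_poly (mat_delete A i i))"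
  proof (rule sum.cong)
    fix i assume "i \<in> {..<n}"
    then have i: "i < n" by simp
    have "mat_delete M i i = char_poly_matrix (mat_delete A i i)"
      unfolding M_def char_poly_matrix_def mat_delete_def using A i by (intro eq_matI) auto
    then show "adj_mat M $$ (i, i) = char_poly (mat_delete A i i)"
      using i M by (simp add: adj_mat_def cofactor_def char_poly_def)
  qed simp
  also have "\<dots> = pderiv (char_poly A)"
    by (rule pderiv_char_poly[OF A, symmetric])
  finally show ?thesis .
qed

section \<open>Parity of the characteristic polynomial of a skew-symmetric matrix\<close>

text \<open>Skew-symmetry gives -xI - S = -(xI - S)^T, so chi(-x) = (-1)^n chi(x). A coefficient of
  the wrong parity equals its own negative, which forces it to be 0 in characteristic 0; over F_2
  the same comparison would say nothing.\<close>

lemma coeff_char_poly_skew_symmetric: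
  fixes S :: "'a :: {idom, ring_char_0} mat"
  assumes S: "S \<in> carrier_mat n n" and skew: "S\<^sup>T = - S" and odd: "odd (n + i)"
  shows "coeff (char_poly S) i = 0"
proof -
  have hom: "comm_ring_hom (\<lambda>p :: 'a poly. p \<circ>\<^sub>p [:0, -1:])"
    by unfold_locales (auto simp: pcompose_add pcompose_mult)
  define M where "M = char_poly_matrix S"
  have M: "M \<in> carrier_mat n n" unfolding M_def using S by simp
  have S': "S $$ (j, i) = - S $$ (i, j)" if "i < n" "j < n" for i j
    using skew S that by (metis carrier_matD index_transpose_mat(1) index_uminus_mat(1))
  have diag: "S $$ (i, i) = 0" if "i < n" for i
  proof -
    have "2 * S $$ (i, i) = 0" using S'[OF that that] by (metis add.right_inverse mult_2)
    then show ?thesis by simp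
  qed
  have "map_mat (\<lambda>p. p \<circ>\<^sub>p [:0, -1:]) M = (-1) \<cdot>\<^sub>m M\<^sup>T"
  proof (rule eq_matI)
    fix i j assume "i < dim_row ((-1) \<cdot>\<^sub>m M\<^sup>T)" "j < dim_col ((-1) \<cdot>\<^sub>m M\<^sup>T)"
    then have ij: "i < n" "j < n" using M by auto
    show "map_mat (\<lambda>p. p \<circ>\<^sub>p [:0, -1:]) M $$ (i, j) = ((-1) \<cdot>\<^sub>m M\<^sup>T) $$ (i, j)"
    proof (cases "i = j")
      case True
      then show ?thesis
        unfolding M_def char_poly_matrix_def using S ij diag by (simp add: pcompose_pCons)
    next
      case False
      then show ?thesis
        unfolding M_def char_poly_matrix_def using S ij S'[OF ij] by (simp add: pcompose_pCons)
    qed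
  qed (use M in auto)
  then have "char_poly S \<circ>\<^sub>p [:0, -1:] = det ((-1) \<cdot>\<^sub>m M\<^sup>T)"
    using comm_ring_hom.hom_det[OF hom, of M] by (simp add: char_poly_def M_def)
  also have "\<dots> = (-1) ^ n * char_poly S"
    using M det_transpose[OF M] by (simp add: char_poly_def M_def)
  finally have "(-1) ^ i * coeff (char_poly S) i = coeff ((-1) ^ n * char_poly S) i"
    by (metis coeff_pcompose_linear)
  also have "\<dots> = (-1) ^ n * coeff (char_poly S) i"
    by (cases "even n") auto
  finally show ?thesis
    using odd by (cases "even n") auto
qed

section \<open>Monic polynomials, squares and \<open>poly_sqrt\<close>\<close>

text \<open>\<open>prime\<close> includes being normalized, and over a field the unit factor of a
  nonzero polynomial is its leading coefficient. This identifies the monic irreducibles in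
  \<open>poly_sqrt\<close> with the primes.\<close>

lemma lead_coeff_prime_poly:
  fixes p :: "'a :: field_gcd poly"
  assumes "prime p"
  shows "lead_coeff p = 1"
proof -
  have p: "normalize p = p" "p \<noteq> 0" using assms by auto
  then have "unit_factor p = 1" by (metis unit_factor_normalize)
  then have "unit_factor (lead_coeff p) = 1" by (simp add: unit_factor_poly_def one_pCons)
  moreover have "unit_factor (lead_coeff p) = lead_coeff p"
    using p by (intro is_unit_unit_factor) (simp add: dvd_field_iff)
  ultimately show ?thesis by simp
qed

lemma normalize_monic_poly:
  fixes p :: "'a :: field_gcd poly"
  assumes "lead_coeff p = 1"
  shows "normalize p = p"
  using assms by (simp add: normalize_poly_eq_map_poly map_poly_idI)

text \<open>Squaring keeps the prime factors and doubles their multiplicities, so the ceilings are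
  exact and the product is the prime factorization of \<open>g\<close>; monicity removes the unit
  factor.\<close>

lemma poly_sqrt_power2:
  fixes g :: "'a :: field_gcd poly"
  assumes "lead_coeff g = 1"
  shows "poly_sqrt (g ^ 2) = g"
proof -
  have g: "g \<noteq> 0" using assms by auto
  have prime: "prime p \<longleftrightarrow> irreducible p \<and> lead_coeff p = 1" for p :: "'a poly"
    using lead_coeff_prime_poly[of p]
    by (auto simp: prime_def normalize_monic_poly prime_elem_iff_irreducible)
  have "poly_sqrt (g ^ 2) = (\<Prod>p\<in>prime_factors g. p ^ multiplicity p g)"
    unfolding poly_sqrt_def
  proof (rule prod.cong)
    show "{p. irreducible p \<and> lead_coeff p = 1 \<and> p dvd g ^ 2} = prime_factors g"
      using g by (auto simp: in_prime_factors_iff prime prime_dvd_power_iff dest: prime_dvd_power)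
  next
    fix p assume "p \<in> prime_factors g"
    then have "multiplicity p (g ^ 2) = 2 * multiplicity p g"
      using g by (intro prime_elem_multiplicity_power_distrib) (auto dest: in_prime_factors_imp_prime)
    then show "p ^ nat \<lceil>real (multiplicity p (g ^ 2)) / 2\<rceil> = p ^ multiplicity p g"
      by simp
  qed
  also have "\<dots> = g"
    using prod_prime_factors[OF g] normalize_monic_poly[OF assms] by simp
  finally show ?thesis .
qed

text \<open>Frobenius: in (a + x p)^2 the cross term has the factor 2, and a^2 = a in F_2, so g(x)^2
  = g(x^2).\<close>

lemma coeff_power2_bit_poly:
  fixes g :: "bit poly"
  shows "coeff (g ^ 2) i = (if even i then coeff g (i div 2) else 0)"
proof (induction g arbitrary: i)
  case (pCons a p)
  have "(2 :: bit poly) = 0"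
    by (metis bit_2_eq_0 of_nat_numeral of_nat_poly pCons_0_0)
  have "pCons a p ^ 2 = pCons (a ^ 2) (pCons 0 (p ^ 2)) + 2 * pCons 0 (Polynomial.smult a p)"
    by (simp add: power2_eq_square algebra_simps mult_2)
  then have "pCons a p ^ 2 = pCons a (pCons 0 (p ^ 2))"
    using \<open>2 = 0\<close> by simp
  then show ?case
    by (cases i rule: nat.exhaust; cases "i - 1") (auto simp: pCons.IH)
qed simp

text \<open>Used both for the characteristic polynomial and, with the even-indexed coefficients
  only, for its half-degree counterpart.\<close>

lemma coeff_descending_poly:
  fixes c :: "nat \<Rightarrow> 'a :: comm_semiring_1"
  shows "coeff (monom 1 n + (\<Sum>k = 1..n. monom (c k) (n - k))) i
    = (if i < n then c (n - i) else if i = n then 1 else 0)"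
proof -
  have "(\<Sum>k = 1..n. coeff (monom (c k) (n - k)) i) = (\<Sum>k = 1..n. if k = n - i \<and> i < n then c k else 0)"
    by (intro sum.cong) auto
  then show ?thesis
    by (auto simp: coeff_sum)
qed

section \<open>Reduction modulo 2 and adjacency matrices\<close>

lemma poly_cong_2_if_reduce_mod2_eq:
  assumes "reduce_mod2 f = reduce_mod2 g"
  shows "poly_cong f g 2"
  unfolding poly_cong_def
proof
  fix i
  have "(of_int (coeff f i) :: bit) = of_int (coeff g i)"
    using arg_cong[OF assms, of "\<lambda>p. coeff p i"] by (simp add: coeff_map_poly)
  then have "(of_int (coeff f i - coeff g i) :: bit) = 0" by simp
  moreover have "(of_int k :: bit) = 1" if "odd k" for k
    using that by (elim oddE) simp
  ultimately have "even (coeff f i - coeff g i)" by fastforce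
  then show "[coeff f i = coeff g i] (mod 2)"
    by (simp add: cong_iff_dvd_diff)
qed

text \<open>Modulo 2 the symmetric matrix \<open>A\<close> agrees with the skew-symmetric matrix obtained by
  negating its lower triangle, whose characteristic polynomial is even or odd already over the
  integers.\<close>

lemma coeff_reduce_mod2_char_poly_symmetric:
  fixes A :: "int mat"
  assumes A: "A \<in> carrier_mat n n" and sym: "A\<^sup>T = A" and diag: "\<And>i. i < n \<Longrightarrow> A $$ (i, i) = 0"
    and odd: "odd (n + i)"
  shows "coeff (reduce_mod2 (char_poly A)) i = 0"
proof -
  \<comment> \<open>The diagonal falls into the second branch, where \<open>diag\<close> makes the
    entry 0, as skew-symmetry over the integers demands.\<close>
  define S where "S = mat n n (\<lambda>(i, j). if i < j then A $$ (i, j) else - A $$ (i, j))"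
  have S: "S \<in> carrier_mat n n" unfolding S_def by simp
  have A': "A $$ (j, i) = A $$ (i, j)" if "i < n" "j < n" for i j
    using that A sym by (metis carrier_matD index_transpose_mat(1))
  have "S\<^sup>T = - S"
  proof (rule eq_matI)
    fix i j assume "i < dim_row (- S)" "j < dim_col (- S)"
    then have "i < n" "j < n" using S by auto
    then show "S\<^sup>T $$ (i, j) = (- S) $$ (i, j)"
      using A'[of i j] diag[of i] by (cases i j rule: linorder_cases) (auto simp: S_def)
  qed (auto simp: S_def)
  have "(of_int (- k) :: bit) = of_int k" for k
    by (cases "even k") auto
  then have "map_mat (of_int :: int \<Rightarrow> bit) A = map_mat of_int S"
    using A by (intro eq_matI) (auto simp: S_def)
  then have "reduce_mod2 (char_poly A) = reduce_mod2 (char_poly S)"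
    using of_int_hom.char_poly_hom[OF A] of_int_hom.char_poly_hom[OF S] by metis
  then show ?thesis
    using coeff_char_poly_skew_symmetric[OF S \<open>S\<^sup>T = - S\<close> odd] by (simp add: coeff_map_poly)
qed

text \<open>Reduction modulo 2 commutes with forming the characteristic polynomial, so the second
  argument of the gcd is X + X'; subtracting the first leaves X'.\<close>

lemma Phi2_symmetric:
  fixes A :: "int mat"
  assumes A: "A \<in> carrier_mat n n" and sym: "A\<^sup>T = A"
  shows "Phi2 A = gcd (reduce_mod2 (char_poly A)) (pderiv (reduce_mod2 (char_poly A)))"
proof -
  let ?a = "map_mat of_int A :: bit mat"
  have a: "?a \<in> carrier_mat n n" using A by simp
  have "?a\<^sup>T = ?a" using sym by (metis map_mat_transpose)
  moreover have "map_mat of_int (A + all_ones_matrix n) = ?a + mat n n (\<lambda>_. 1)"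
    using A by (intro eq_matI) (auto simp: all_ones_matrix_def)
  moreover have "A + all_ones_matrix n \<in> carrier_mat n n"
    by (simp add: all_ones_matrix_def)
  ultimately have "reduce_mod2 (char_poly (A + all_ones_matrix n))
      = reduce_mod2 (char_poly A) + pderiv (reduce_mod2 (char_poly A))"
    using of_int_hom.char_poly_hom[OF A, where ?'a = bit] char_poly_add_all_ones_char_2[OF a]
      of_int_hom.char_poly_hom[of "A + all_ones_matrix n" n, where ?'a = bit]
    by (metis bit_2_eq_0)
  then show ?thesis
    using A unfolding Phi2_def by (metis carrier_matD(1) gcd_add2)
qed

lemma adjacency_matrix_symmetric:
  assumes "graph G" and A: "A = adjacency_matrix G vs"
  shows "A\<^sup>T = A" and "i < length vs \<Longrightarrow> A $$ (i, i) = 0"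
proof -
  interpret graph G by fact
  have "vs ! i \<rightarrow>\<^bsub>G\<^esub> vs ! j \<longleftrightarrow> vs ! j \<rightarrow>\<^bsub>G\<^esub> vs ! i" for i j
    using sym_arcs by (meson arcs_ends_symmetric)
  then show "A\<^sup>T = A"
    unfolding A adjacency_matrix_def by (intro eq_matI) auto
  have "\<not> v \<rightarrow>\<^bsub>G\<^esub> v" for v
    using no_loops by (auto simp: arcs_ends_conv)
  then show "i < length vs \<Longrightarrow> A $$ (i, i) = 0"
    unfolding A adjacency_matrix_def by simp
qed

section \<open>Even and odd order\<close>

theorem theorem4p1:
  fixes G :: "('a, 'b) pre_digraph" and vs :: "'a list" and n :: nat
    and c :: "nat \<Rightarrow> int" and A :: "int mat" and f :: "int poly"
  assumes "graph G" and "card (verts G) = n"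
    and "distinct vs" and "set vs = verts G"
    and "A = adjacency_matrix G vs"
    and "char_poly A = monom 1 n + (\<Sum>k = 1..n. monom (c k) (n - k))"
    and "lead_coeff f = 1"
    and "reduce_mod2 f = reduce_mod2 (char_poly A) div poly_sqrt (Phi2 A)"
  shows "if even n
    then poly_cong f
           (monom 1 (n div 2) + (\<Sum>k = 1..n div 2. monom (c (2 * k)) ((n - 2 * k) div 2))) 2
    else poly_cong f
           (monom 1 1 * (monom 1 ((n - 1) div 2) +
              (\<Sum>k = 1..(n - 1) div 2. monom (c (2 * k)) ((n - 1 - 2 * k) div 2)))) 2"
proof -
  have "length vs = n"
    using assms(2-4) by (metis distinct_card)
  then have A: "A \<in> carrier_mat n n"
    by (simp add: assms(5) adjacency_matrix_def)
  have sym: "A\<^sup>T = A" and diag: "\<And>i. i < n \<Longrightarrow> A $$ (i, i) = 0"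
    using adjacency_matrix_symmetric[OF assms(1,5)] \<open>length vs = n\<close> by auto
  define X where "X = reduce_mod2 (char_poly A)"
  \<comment> \<open>Rounding n/2 down lets the same \<open>h\<close>, which carries c_2k in degree m
    - k, serve both parities.\<close>
  define m where "m = n div 2"
  define h where "h = monom 1 m + (\<Sum>k = 1..m. monom (c (2 * k)) (m - k))"
  define g where "g = reduce_mod2 h"
  note phi = Phi2_symmetric[OF A sym, folded X_def]
  have X0: "coeff X i = 0" if "odd (n + i)" for i
    unfolding X_def by (rule coeff_reduce_mod2_char_poly_symmetric[OF A sym diag that])
  have X: "coeff X i = (if i < n then of_int (c (n - i)) else if i = n then 1 else 0)" for i
    unfolding X_def assms(6) by (subst coeff_map_poly, simp, subst coeff_descending_poly) simp
  have g: "coeff g i = (if i < m then of_int (c (2 * (m - i))) else if i = m then 1 else 0)" for i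
    unfolding g_def h_def by (subst coeff_map_poly, simp, subst coeff_descending_poly) simp
  have "degree g = m"
    by (intro order_antisym degree_le le_degree) (auto simp: g)
  then have monic: "lead_coeff g = 1" by (simp add: g)
  then have "g \<noteq> 0" by auto
  \<comment> \<open>The gcd is returned in normalized form; this makes it \<open>g ^ 2\<close>
    itself and not just an associate.\<close>
  have monic2: "normalize (g ^ 2) = g ^ 2"
    using monic by (intro normalize_monic_poly) (simp add: lead_coeff_power)
  have two: "(2 :: bit poly) = 0"
    by (metis bit_2_eq_0 of_nat_numeral of_nat_poly pCons_0_0)
  have pderiv: "pderiv (g ^ 2) = 0"
    by (simp add: power2_eq_square pderiv_mult mult.commute two flip: mult_2)
  show ?thesis
  proof (cases "even n")
    case True
    then have n: "n = 2 * m" by (simp add: m_def)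
    \<comment> \<open>Odd degrees vanish by \<open>X0\<close>; in degree 2j both sides have the
      coefficient c_(n-2j) = c_(2(m-j)), or 1 if j = m.\<close>
    have "X = g ^ 2"
      using X0 by (intro poly_eqI)
        (auto simp: X g coeff_power2_bit_poly n diff_mult_distrib2 elim!: evenE)
    then have "poly_sqrt (Phi2 A) = g"
      using pderiv monic2 by (simp add: phi poly_sqrt_power2[OF monic])
    then have "reduce_mod2 f = g"
      using assms(8) \<open>X = g ^ 2\<close> \<open>g \<noteq> 0\<close> by (simp add: X_def power2_eq_square)
    then have "poly_cong f h 2"
      by (intro poly_cong_2_if_reduce_mod2_eq) (simp add: g_def)
    moreover have "(n - 2 * k) div 2 = m - k" for k
      by (simp add: n flip: diff_mult_distrib2)
    ultimately show ?thesis
      using True by (simp add: h_def m_def)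
  next
    case False
    then have n: "n = 2 * m + 1" by (simp add: m_def)
    have mon: "monom 1 1 * p = pCons 0 p" for p :: "'z :: comm_ring_1 poly"
      by (simp add: monom_altdef)
    \<comment> \<open>The factor x shifts degrees by one, and n - (2j+1) = 2(m-j). Even degrees,
      including 0, vanish by \<open>X0\<close>.\<close>
    have "X = pCons 0 (g ^ 2)"
    proof (rule poly_eqI)
      fix i
      show "coeff X i = coeff (pCons 0 (g ^ 2)) i"
      proof (cases i)
        case (Suc j)
        then show ?thesis
          using X0[of i]
          by (cases "even j") (auto simp: X g coeff_power2_bit_poly n diff_mult_distrib2 elim!: evenE)
      qed (use X0[of 0] n in simp)
    qed
    \<comment> \<open>By the product rule (x g^2)' = g^2 + x (g^2)', and the derivative of the
      square is 0.\<close>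
    moreover from this have "pderiv X = g ^ 2"
      by (simp add: pderiv_pCons pderiv)
    moreover have "g ^ 2 dvd pCons 0 (g ^ 2)"
      by (metis dvd_triv_right mon)
    ultimately have "Phi2 A = g ^ 2"
      using monic2 by (simp add: phi gcd_proj2_if_dvd)
    then have "poly_sqrt (Phi2 A) = g"
      by (simp add: poly_sqrt_power2[OF monic])
    moreover have "X = pCons 0 g * g"
      using \<open>X = pCons 0 (g ^ 2)\<close> by (simp add: power2_eq_square)
    ultimately have "reduce_mod2 f = pCons 0 g"
      using assms(8)[folded X_def] \<open>g \<noteq> 0\<close> by (metis nonzero_mult_div_cancel_right)
    then have "poly_cong f (monom 1 1 * h) 2"
      by (intro poly_cong_2_if_reduce_mod2_eq poly_eqI)
        (simp add: g_def mon coeff_map_poly coeff_pCons del: One_nat_def split: nat.split)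
    moreover have "(n - 1 - 2 * k) div 2 = m - k" for k
      by (simp add: n flip: diff_mult_distrib2)
    ultimately show ?thesis
      using False by (simp add: h_def n)
  qed
qed

end
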